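(* Let $k\ge 0$ be an integer. The radial extension maps boundary data $\alpha$ of class $C^{k}(B)$ to an interior field $\Phi=\tilde\Phi(\alpha)$ of class $C^{0}(\mathrm{int}(B)\setminus\{x_0\})$.
   Context: $U\subset\mathbb{R}^n$ is an open star-shaped set with center $x_0$, and $B\subset U$ is a regular convex closed (hyper)surface (a two-point set if $n=1$) enclosing a region $\mathrm{int}(B)$ that contains $x_0$. $V$ is a finite-dimensional vector space; data are functions (coefficients) with values in $V$. Radial extension: every $x\in\mathrm{int}(B)\setminus\{x_0\}$ can be written as $x=x_0+t_x(x_b-x_0)$ with $x_b\in B$ and $t_x\in(0,1)$, i.e. $x$ lies on the ray segment $[x_0,x_b]$. The radial extension of $\alpha$ is constant along these rays with value equal to that at the boundary: $\tilde\Phi(\alpha)(x)=\alpha(x_b)$. *)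

theory Defs
  imports "HOL-Analysis.Analysis"
begin

text \<open>\<open>Ck_on k W f\<close> says that \<open>f\<close> is of class \<open>C\<close>-\<open>k\<close> on \<open>W\<close>; it is meant for open \<open>W\<close> only,
  since the derivatives are taken in the full space.\<close>

primrec Ck_on :: "nat \<Rightarrow> 'a::euclidean_space set \<Rightarrow> ('a \<Rightarrow> 'b::real_normed_vector) \<Rightarrow> bool" where
  "Ck_on 0 W f \<longleftrightarrow> continuous_on W f"
| "Ck_on (Suc k) W f \<longleftrightarrow>
     (\<forall>x\<in>W. f differentiable (at x)) \<and> (\<forall>v. Ck_on k W (\<lambda>x. frechet_derivative f (at x) v))"

text \<open>Embedded hypersurface of class \<open>C\<close>-\<open>r\<close> (meaningful for \<open>r \<ge> 1\<close>): locally the zero set of a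
  real function of class \<open>C\<close>-\<open>r\<close> whose derivative vanishes at no point of the zero set.\<close>

definition regular_hypersurface :: "nat \<Rightarrow> 'a::euclidean_space set \<Rightarrow> bool" where
  "regular_hypersurface r B \<longleftrightarrow>
     (\<forall>p\<in>B. \<exists>W (F :: 'a \<Rightarrow> real). open W \<and> p \<in> W \<and> Ck_on r W F \<and>
        B \<inter> W = {x\<in>W. F x = 0} \<and>
        (\<forall>x\<in>B \<inter> W. frechet_derivative F (at x) \<noteq> (\<lambda>v. 0)))"

text \<open>Boundary of a convex body. In dimension one these are exactly the two-point sets. The region
  enclosed by such a \<open>B\<close> is the library's \<open>inside B\<close>.\<close>

definition convex_closed_surface :: "'a::euclidean_space set \<Rightarrow> bool" where
  "convex_closed_surface B \<longleftrightarrow>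
     (\<exists>C. compact C \<and> convex C \<and> interior C \<noteq> {} \<and> B = frontier C)"

text \<open>Functions of class \<open>C\<close>-\<open>k\<close> on a hypersurface: those that extend locally to functions of
  class \<open>C\<close>-\<open>k\<close> on the ambient space. Values of \<open>\<alpha>\<close> off \<open>B\<close> play no role.\<close>

definition Ck_surface :: "nat \<Rightarrow> 'a::euclidean_space set \<Rightarrow> ('a \<Rightarrow> 'b::real_normed_vector) \<Rightarrow> bool" where
  "Ck_surface k B \<alpha> \<longleftrightarrow>
     (\<forall>p\<in>B. \<exists>W g. open W \<and> p \<in> W \<and> Ck_on k W g \<and> (\<forall>x\<in>B \<inter> W. g x = \<alpha> x))"

definition star_shaped_at :: "'a::real_vector \<Rightarrow> 'a set \<Rightarrow> bool" where
  "star_shaped_at x0 U \<longleftrightarrow> x0 \<in> U \<and> (\<forall>x\<in>U. closed_segment x0 x \<subseteq> U)"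

text \<open>For a convex closed surface \<open>B\<close> with \<open>x0 \<in> inside B\<close>, exactly one such \<open>b\<close> exists for each
  \<open>x \<in> inside B - {x0}\<close>; elsewhere the value is irrelevant.\<close>

definition radial_point :: "'a::real_vector \<Rightarrow> 'a set \<Rightarrow> 'a \<Rightarrow> 'a" where
  "radial_point x0 B x =
     (THE b. b \<in> B \<and> (\<exists>t\<in>{0<..<1::real}. x = x0 + t *\<^sub>R (b - x0)))"

definition radial_extension :: "'a::real_vector \<Rightarrow> 'a set \<Rightarrow> ('a \<Rightarrow> 'b) \<Rightarrow> 'a \<Rightarrow> 'b" where
  "radial_extension x0 B \<alpha> x = \<alpha> (radial_point x0 B x)"

end

theory Submission
  imports Defs
begin

text \<open>The map sending a boundary point \<open>b\<close> to the unit direction of \<open>b - x0\<close> is continuous, and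
  injective on \<open>B\<close> by convexity. Since \<open>B\<close> is compact, its inverse is continuous, and the radial
  point of \<open>x\<close> is the value of this inverse at the direction of \<open>x - x0\<close>.\<close>

lemma Ck_on_imp_continuous_on:
  assumes "Ck_on k W f"
  shows "continuous_on W f"
proof (cases k)
  case 0
  then show ?thesis using assms by simp
next
  case (Suc m)
  then show ?thesis
    using assms by (auto intro!: continuous_at_imp_continuous_on differentiable_imp_continuous_within)
qed

text \<open>Near each \<open>p\<close> the function agrees on \<open>B\<close> with a continuous
  local extension, and continuity at \<open>p\<close> within \<open>B\<close> depends only on the
  values in a neighbourhood of \<open>p\<close>.\<close>

lemma Ck_surface_imp_continuous_on:
  assumes "Ck_surface k B \<alpha>"
  shows "continuous_on B \<alpha>"
  unfolding continuous_on_eq_continuous_within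
proof
  fix p assume "p \<in> B"
  then obtain W g where W: "open W" "p \<in> W" "Ck_on k W g" and eq: "\<And>x. x \<in> B \<inter> W \<Longrightarrow> g x = \<alpha> x"
    using assms unfolding Ck_surface_def by meson
  have "continuous_on (B \<inter> W) g"
    using Ck_on_imp_continuous_on[OF W(3)] continuous_on_subset by blast
  then have "continuous_on (B \<inter> W) \<alpha>"
    using eq by (rule continuous_on_eq)
  then have "continuous (at p within B \<inter> W) \<alpha>"
    using \<open>p \<in> B\<close> W(2) by (simp add: continuous_on_eq_continuous_within)
  moreover have "at p within B \<inter> W = at p within B"
    by (rule at_within_nhd[OF W(2,1)]) auto
  ultimately show "continuous (at p within B) \<alpha>" by simp
qed

text \<open>In a convex set, a segment from an interior point to a point of the closure runs through
  the interior, except possibly at its far end.\<close>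

lemma scaled_frontier_point_in_interior:
  fixes C :: "'a::euclidean_space set"
  assumes "convex C" "x0 \<in> interior C" "b \<in> frontier C" "0 \<le> t" "t < 1"
  shows "x0 + t *\<^sub>R (b - x0) \<in> interior C"
proof (cases "t = 0")
  case False
  have "b \<noteq> x0" using assms unfolding frontier_def by auto
  then have "x0 + t *\<^sub>R (b - x0) \<in> open_segment x0 b"
    using assms False by (auto simp: in_segment algebra_simps intro!: exI[of _ t])
  moreover have "b \<in> closure C" using assms by (simp add: frontier_def)
  ultimately show ?thesis
    using in_interior_closure_convex_segment[OF assms(1,2)] by blast
qed (use assms in simp)

text \<open>Both sides are \<open>norm u * norm v\<close> times the common direction; the form
  without division also covers zero vectors.\<close>

lemma sgn_eq_imp_scaleR:
  fixes u v :: "'a::real_normed_vector"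
  assumes "sgn u = sgn v"
  shows "norm v *\<^sub>R u = norm u *\<^sub>R v"
proof -
  have polar: "norm w *\<^sub>R sgn w = w" for w :: 'a
    by (cases "w = 0") (simp_all add: sgn_div_norm)
  show ?thesis using polar[of u] polar[of v] assms by (metis scaleR_left_commute)
qed

lemma sgn_eq_norm_less_imp_scaled:
  fixes u v :: "'a::real_normed_vector"
  assumes "sgn u = sgn v" "norm u < norm v"
  shows "\<exists>t. 0 \<le> t \<and> t < 1 \<and> u = t *\<^sub>R v"
proof (intro exI conjI)
  have "v \<noteq> 0" using assms(2) by auto
  then show "0 \<le> norm u / norm v" "norm u / norm v < 1" using assms(2) by auto
  have "u = inverse (norm v) *\<^sub>R (norm v *\<^sub>R u)" using \<open>v \<noteq> 0\<close> by simp
  then show "u = (norm u / norm v) *\<^sub>R v"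
    unfolding sgn_eq_imp_scaleR[OF assms(1)] by (simp add: divide_inverse mult.commute)
qed

text \<open>If \<open>y\<close> were closer to \<open>x0\<close> than \<open>b\<close>, it would lie
  on the segment from \<open>x0\<close> to \<open>b\<close> before \<open>b\<close>, hence in the
  interior.\<close>

lemma norm_le_frontier_in_direction:
  fixes C :: "'a::euclidean_space set"
  assumes "convex C" "x0 \<in> interior C" "b \<in> frontier C" "y \<notin> interior C"
    and "sgn (y - x0) = sgn (b - x0)"
  shows "norm (b - x0) \<le> norm (y - x0)"
proof (rule ccontr)
  assume "\<not> ?thesis"
  then obtain t where t: "0 \<le> t" "t < 1" "y - x0 = t *\<^sub>R (b - x0)"
    using sgn_eq_norm_less_imp_scaled[OF assms(5)] by auto
  then have "y = x0 + t *\<^sub>R (b - x0)" by (metis add.commute diff_add_cancel)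
  then show False using scaled_frontier_point_in_interior[OF assms(1-3) t(1,2)] assms(4) by simp
qed

text \<open>Frontier points are not interior, so of two in the same direction neither can be the
  closer one; equal direction and equal distance from \<open>x0\<close> then force equality.\<close>

lemma inj_on_direction_frontier:
  fixes C :: "'a::euclidean_space set"
  assumes "convex C" "x0 \<in> interior C"
  shows "inj_on (\<lambda>b. sgn (b - x0)) (frontier C)"
proof (rule inj_onI)
  fix a b assume ab: "a \<in> frontier C" "b \<in> frontier C" "sgn (a - x0) = sgn (b - x0)"
  then have out: "a \<notin> interior C" "b \<notin> interior C" by (auto simp: frontier_def)
  have "norm (a - x0) = norm (b - x0)"
    using norm_le_frontier_in_direction[OF assms ab(1) out(2)]
      norm_le_frontier_in_direction[OF assms ab(2) out(1)] ab(3) by simp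
  \<comment> \<open>The common norm has to be cancelled below.\<close>
  moreover have "norm (a - x0) \<noteq> 0" using out assms(2) by auto
  ultimately have "a - x0 = b - x0"
    using sgn_eq_imp_scaleR[OF ab(3)] by simp
  then show "a = b" by simp
qed

text \<open>The description in \<open>radial_point\<close> is proper: the ray from \<open>x0\<close>
  through \<open>x\<close> must leave the bounded set, which gives existence, and injectivity of the
  direction map gives uniqueness.\<close>

lemma radial_point_frontier:
  fixes C :: "'a::euclidean_space set"
  assumes "bounded C" "convex C" "x0 \<in> interior C" "x \<in> interior C" "x \<noteq> x0"
  shows "radial_point x0 (frontier C) x \<in> frontier C"
    and "sgn (radial_point x0 (frontier C) x - x0) = sgn (x - x0)"
proof -
  define P where "P b \<longleftrightarrow> b \<in> frontier C \<and> (\<exists>t\<in>{0<..<1::real}. x = x0 + t *\<^sub>R (b - x0))" for b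
  have sgnP: "sgn (b - x0) = sgn (x - x0)" if "P b" for b
    using that unfolding P_def by (auto simp: sgn_scaleR)
  obtain d where d: "0 < d" "x0 + d *\<^sub>R (x - x0) \<in> frontier C"
    using ray_to_frontier[OF assms(1,3), of "x - x0"] assms(5) by auto
  \<comment> \<open>Here \<open>d\<close> is the exit parameter in units of \<open>x - x0\<close>.
    An exit before \<open>x\<close> would put a frontier point between \<open>x0\<close> and
    \<open>x\<close>, where all points are interior.\<close>
  have "1 < d"
  proof (rule ccontr)
    assume "\<not> 1 < d"
    moreover have "d \<noteq> 1" using d(2) assms(4) by (auto simp: frontier_def)
    ultimately have "x0 + d *\<^sub>R (x - x0) \<in> open_segment x0 x"
      using d(1) assms(5) by (auto simp: in_segment algebra_simps intro!: exI[of _ d])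
    moreover have "x \<in> closure C" using assms(4) interior_subset closure_subset by blast
    ultimately show False
      using in_interior_closure_convex_segment[OF assms(2,3)] d(2) by (auto simp: frontier_def)
  qed
  \<comment> \<open>Seen from the exit point, \<open>x\<close> has parameter
    \<open>inverse d\<close>, which is below 1 because \<open>1 < d\<close>.\<close>
  then have "P (x0 + d *\<^sub>R (x - x0))"
    unfolding P_def using d by (intro conjI bexI[of _ "inverse d"]) (simp_all add: inverse_less_1_iff)
  moreover have "b = b'" if "P b" "P b'" for b b'
    using inj_onD[OF inj_on_direction_frontier[OF assms(2,3)], of b b'] sgnP[OF that(1)] sgnP[OF that(2)] that
    by (simp add: P_def)
  ultimately have "P (radial_point x0 (frontier C) x)"
    unfolding radial_point_def P_def[symmetric] by (metis theI)
  then show "radial_point x0 (frontier C) x \<in> frontier C"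
    "sgn (radial_point x0 (frontier C) x - x0) = sgn (x - x0)"
    using sgnP by (auto simp: P_def)
qed

lemma continuous_on_radial_point:
  fixes C :: "'a::euclidean_space set"
  assumes "bounded C" "convex C" "x0 \<in> interior C"
  shows "continuous_on (interior C - {x0}) (radial_point x0 (frontier C))"
proof -
  let ?h = "\<lambda>b. sgn (b - x0)"
  define g where "g = inv_into (frontier C) ?h"
  have inj: "inj_on ?h (frontier C)" by (rule inj_on_direction_frontier[OF assms(2,3)])
  have "x0 \<notin> frontier C" using assms(3) by (simp add: frontier_def)
  then have "continuous_on (frontier C) ?h"
    by (auto simp: sgn_div_norm intro!: continuous_intros)
  then have g: "continuous_on (?h ` frontier C) g"
    by (rule continuous_on_inv) (simp_all add: assms(1) compact_frontier_bounded g_def inv_into_f_f[OF inj])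
  \<comment> \<open>The direction is continuous away from \<open>x0\<close>, which is why the centre
    is removed.\<close>
  have "continuous_on (interior C - {x0}) ?h"
    by (auto simp: sgn_div_norm intro!: continuous_intros)
  \<comment> \<open>The radial point of \<open>x\<close> attains the direction of \<open>x\<close>
    on the frontier, so \<open>g\<close> is applied only where it is continuous.\<close>
  moreover have "?h x \<in> ?h ` frontier C" if "x \<in> interior C - {x0}" for x
    using that radial_point_frontier[OF assms, of x]
    by (intro image_eqI[of _ _ "radial_point x0 (frontier C) x"]) auto
  ultimately have "continuous_on (interior C - {x0}) (\<lambda>x. g (?h x))"
    by (intro continuous_on_compose2[OF g]) auto
  moreover have "g (?h x) = radial_point x0 (frontier C) x" if "x \<in> interior C - {x0}" for x
    using that radial_point_frontier[OF assms, of x] inv_into_f_f[OF inj]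
    unfolding g_def by (metis DiffD1 DiffD2 singletonI)
  ultimately show ?thesis by (rule continuous_on_eq)
qed

theorem proposition2:
  fixes U B :: "(real ^ 'n) set" and x0 :: "real ^ 'n"
    and \<alpha> :: "real ^ 'n \<Rightarrow> 'v::real_normed_vector"
    and k r :: nat
  assumes "\<exists>E. finite E \<and> span E = (UNIV :: 'v set)"
    and "open U" and "star_shaped_at x0 U"
    and "1 \<le> r" and "k \<le> r"
    and "regular_hypersurface r B" and "convex_closed_surface B"
    and "B \<subseteq> U" and "x0 \<in> inside B"
    and "Ck_surface k B \<alpha>"
  shows "continuous_on (inside B - {x0}) (radial_extension x0 B \<alpha>)"
proof -
  obtain C where C: "compact C" "convex C" and B: "B = frontier C"
    using assms(7) unfolding convex_closed_surface_def by blast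
  have bounded: "bounded C" using C(1) by (rule compact_imp_bounded)
  have inside: "inside B = interior C"
    unfolding B by (rule inside_frontier_eq_interior[OF bounded C(2)])
  have x0: "x0 \<in> interior C" using assms(9) inside by simp
  \<comment> \<open>Continuity of \<alpha> is known only on \<open>B\<close>, so the composition
    needs radial points to lie there.\<close>
  have "radial_point x0 B ` (interior C - {x0}) \<subseteq> B"
    using radial_point_frontier(1)[OF bounded C(2) x0] B by auto
  then have "continuous_on (interior C - {x0}) (\<lambda>x. \<alpha> (radial_point x0 B x))"
    using continuous_on_compose2[OF Ck_surface_imp_continuous_on[OF assms(10)]]
      continuous_on_radial_point[OF bounded C(2) x0] B by blast
  then show ?thesis
    unfolding inside radial_extension_def .
qed

end
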